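(* Let $(X,f)$ and $(Y,g)$ be set-function pairs (with $f:X\times X\to\mathbb{R}$, $g:Y\times Y\to\mathbb{R}$ arbitrary functions) with $d_{CD}((X,f),(Y,g))$ finite. Let $\mathcal{D}(X,f)=\{D(X,f)_t\}$ and $\mathcal{D}(Y,g)=\{D(Y,g)_t\}$ be the associated filtrations of directed graphs, and let $P^X$ and $P^Y$ be the strongly connected persistence modules corresponding to $\mathcal{D}(X,f)$ and $\mathcal{D}(Y,g)$. Then $$d_{int}(P^X,P^Y)\le 2\,d_{CD}((X,f),(Y,g)).$$
   Context: Fix a field $\mathbb{F}$. A set-function pair $(X,f)$ is a set $X$ with a function $f:X\times X\to\mathbb{R}$. A correspondence between $X$ and $Y$ is a subset $\mathcal{M}\subset X\times Y$ such that every $x\in X$ has some $y\in Y$ with $(x,y)\in\mathcal{M}$ and every $y\in Y$ has some $x\in X$ with $(x,y)\in\mathcal{M}$. Its distortion is $dis_{(X,f),(Y,g)}(\mathcal{M})=\sup_{(x_1,y_1),(x_2,y_2)\in\mathcal{M}}|f(x_1,x_2)-g(y_1,y_2)|$. The correspondence distortion distance is $d_{CD}((X,f),(Y,g))=\frac12\inf_{\mathcal{M}}dis_{(X,f),(Y,g)}(\mathcal{M})\in[0,\infty]$, the infimum over all correspondences between $X$ and $Y$. The associated filtration of directed graphs of $(X,f)$ is $\{D(X,f)_t\}_{t\in\mathbb{R}}$, where $D(X,f)_t$ has vertex set $\{x\in X: f(x,x)\le t\}$ and a directed edge $x\to y$ whenever $\max\{f(x,x),f(y,y),f(x,y)\}\le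 t$. A path from $x$ to $y$ in a directed graph is a finite sequence of vertices $x=x_0,x_1,\dots,x_n=y$ with each $x_i\to x_{i+1}$ a directed edge (the one-vertex sequence being a path from $x$ to $x$). Strongly connected components are the equivalence classes of vertices under: $v\sim w$ iff there are a path from $v$ to $w$ and a path from $w$ to $v$. For a filtration of directed graphs $\{D_t\}_{t\in\mathbb{R}}$ ($D_s$ a directed subgraph of $D_t$ for $s\le t$), let $[v]_t$ be the strongly connected component of $v$ in $D_t$. Its strongly connected persistence module has $V_t$ the $\mathbb{F}$-vector space of finite formal linear combinations $\sum_i\lambda_i[v_i]_t$ of strongly connected components of $D_t$, with maps $V_t\to V_s$ ($t\le s$) given by $\sum_i\lambda_i[v_i]_t\mapsto\sum_i\lambda_i[v_i]_s$. A persistence module is a family $\{P_t\}_{t\in\mathbb{R}}$ of $\mathbb{F}$-vector spaces with linear maps $\iota_t^s:P_t\to P_s$ for $t\le s$ such that $\iota_t^t=\mathrm{id}$ and $\iota_t^r=\iota_s^r\circ\iota_t^s$ for $t\le s\le r$. Persistence modules $P^X,P^Y$ are $\epsilon$-interleaved if there are families of linear maps $\alpha_t:P^X_t\to P^Y_{t+\epsilon}$ and $\beta_t:P^Y_t\to P^X_{t+\epsilon}$ ($t\in\mathbb{R}$) that commute with the structure maps ($\alpha_{t'}\circ\iota_t^{t'}=\iota_{t+\epsilon}^{t'+\epsilon}\circ\alpha_t$ and $\beta_{t'}\circ\iota_t^{t'}=\iota_{t+\epsilon}^{t'+\epsilon}\circ\beta_t$ for $t\le t'$) and satisfy $\beta_{t+\epsilon}\circ\alpha_t=\iota_t^{t+2\epsilon}$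 and $\alpha_{t+\epsilon}\circ\beta_t=\iota_t^{t+2\epsilon}$ for all $t$. The interleaving distance $d_{int}(P^X,P^Y)\in[0,\infty]$ is the infimum of all $\epsilon>0$ such that $P^X,P^Y$ are $\epsilon$-interleaved. *)

theory Defs
  imports
    "HOL-Library.Extended_Nonnegative_Real"
    "HOL-Library.Poly_Mapping"
    "Graph_Theory.Graph_Theory"
begin

text \<open>
  A set-function pair is given by a carrier \<open>X\<close> and a function \<open>f\<close>, of which only the values on
  \<open>X \<times> X\<close> are ever used. No finiteness, nonemptiness or metric axiom is imposed.
\<close>

definition correspondence :: "'x set \<Rightarrow> 'y set \<Rightarrow> ('x \<times> 'y) set \<Rightarrow> bool" where
  "correspondence X Y M \<longleftrightarrow>
     M \<subseteq> X \<times> Y \<and> (\<forall>x\<in>X. \<exists>y\<in>Y. (x, y) \<in> M) \<and> (\<forall>y\<in>Y. \<exists>x\<in>X. (x, y) \<in> M)"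

text \<open>
  Suprema and infima are taken in \<^typ>\<open>ennreal\<close>, so that the supremum over the empty
  correspondence is 0 and the infimum over an empty set of correspondences is infinite.
\<close>

definition distortion ::
  "('x \<Rightarrow> 'x \<Rightarrow> real) \<Rightarrow> ('y \<Rightarrow> 'y \<Rightarrow> real) \<Rightarrow> ('x \<times> 'y) set \<Rightarrow> ennreal" where
  "distortion f g M = (SUP (x1, y1)\<in>M. SUP (x2, y2)\<in>M. ennreal \<bar>f x1 x2 - g y1 y2\<bar>)"

definition d_CD ::
  "'x set \<Rightarrow> ('x \<Rightarrow> 'x \<Rightarrow> real) \<Rightarrow> 'y set \<Rightarrow> ('y \<Rightarrow> 'y \<Rightarrow> real) \<Rightarrow> ennreal" where
  "d_CD X f Y g = (1 / 2) * (INF M\<in>{M. correspondence X Y M}. distortion f g M)"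

definition assoc_digraph ::
  "'x set \<Rightarrow> ('x \<Rightarrow> 'x \<Rightarrow> real) \<Rightarrow> real \<Rightarrow> 'x pair_pre_digraph" where
  "assoc_digraph X f t =
     \<lparr> pverts = {x \<in> X. f x x \<le> t},
       parcs = {(x, y). x \<in> X \<and> y \<in> X \<and> Max {f x x, f y y, f x y} \<le> t} \<rparr>"

definition digraph_filtration :: "(real \<Rightarrow> 'a pair_pre_digraph) \<Rightarrow> bool" where
  "digraph_filtration D \<longleftrightarrow> (\<forall>s t. s \<le> t \<longrightarrow> subgraph (with_proj (D s)) (with_proj (D t)))"

definition scc :: "'a pair_pre_digraph \<Rightarrow> 'a \<Rightarrow> 'a set" where
  "scc G v = pre_digraph.scc_of (with_proj G) v"

definition scc_set :: "'a pair_pre_digraph \<Rightarrow> 'a set set" where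
  "scc_set G = scc G ` pverts G"

text \<open>
  The map \<open>[v]\<^sub>t \<mapsto> [v]\<^sub>s\<close> on components: for \<open>t \<le> s\<close> the components in \<open>D s\<close> of all vertices of
  \<open>C \<in> scc_set (D t)\<close> coincide, and \<^const>\<open>the_elem\<close> picks that common value (see
  \<open>scc_map_scc\<close> below).
\<close>

definition scc_map :: "(real \<Rightarrow> 'a pair_pre_digraph) \<Rightarrow> real \<Rightarrow> 'a set \<Rightarrow> 'a set" where
  "scc_map D s C = the_elem (scc (D s) ` C)"

text \<open>
  A family of vector spaces over the field \<open>'k\<close> is represented by carriers \<open>mspace P t\<close> inside one
  ambient vector space \<open>'v\<close> with scalar multiplication \<open>mscale P\<close>; \<open>mmap P t s\<close> is the map from
  \<open>mspace P t\<close> to \<open>mspace P s\<close> and is meaningful on \<open>mspace P t\<close> for \<open>t \<le> s\<close> only.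
\<close>

record ('k, 'v) pmodule =
  mscale :: "'k \<Rightarrow> 'v \<Rightarrow> 'v"
  mspace :: "real \<Rightarrow> 'v set"
  mmap :: "real \<Rightarrow> real \<Rightarrow> 'v \<Rightarrow> 'v"

definition linear_between ::
  "('k::field \<Rightarrow> 'v::ab_group_add \<Rightarrow> 'v) \<Rightarrow> 'v set \<Rightarrow>
   ('k \<Rightarrow> 'w::ab_group_add \<Rightarrow> 'w) \<Rightarrow> 'w set \<Rightarrow> ('v \<Rightarrow> 'w) \<Rightarrow> bool" where
  "linear_between sV V sW W h \<longleftrightarrow>
     (\<forall>x\<in>V. h x \<in> W) \<and>
     (\<forall>x\<in>V. \<forall>y\<in>V. h (x + y) = h x + h y) \<and>
     (\<forall>c. \<forall>x\<in>V. h (sV c x) = sW c (h x))"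

definition persistence_module :: "('k::field, 'v::ab_group_add) pmodule \<Rightarrow> bool" where
  "persistence_module P \<longleftrightarrow>
     vector_space (mscale P) \<and>
     (\<forall>t. module.subspace (mscale P) (mspace P t)) \<and>
     (\<forall>t s. t \<le> s \<longrightarrow>
        linear_between (mscale P) (mspace P t) (mscale P) (mspace P s) (mmap P t s)) \<and>
     (\<forall>t. \<forall>x\<in>mspace P t. mmap P t t x = x) \<and>
     (\<forall>t s r. t \<le> s \<longrightarrow> s \<le> r \<longrightarrow> (\<forall>x\<in>mspace P t. mmap P t r x = mmap P s r (mmap P t s x)))"

definition interleaved ::
  "real \<Rightarrow> ('k::field, 'v::ab_group_add) pmodule \<Rightarrow> ('k, 'w::ab_group_add) pmodule \<Rightarrow> bool" where
  "interleaved \<epsilon> P Q \<longleftrightarrow>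
     (\<exists>\<alpha> \<beta>.
        (\<forall>t. linear_between (mscale P) (mspace P t) (mscale Q) (mspace Q (t + \<epsilon>)) (\<alpha> t)) \<and>
        (\<forall>t. linear_between (mscale Q) (mspace Q t) (mscale P) (mspace P (t + \<epsilon>)) (\<beta> t)) \<and>
        (\<forall>t t'. t \<le> t' \<longrightarrow>
           (\<forall>x\<in>mspace P t. \<alpha> t' (mmap P t t' x) = mmap Q (t + \<epsilon>) (t' + \<epsilon>) (\<alpha> t x))) \<and>
        (\<forall>t t'. t \<le> t' \<longrightarrow>
           (\<forall>y\<in>mspace Q t. \<beta> t' (mmap Q t t' y) = mmap P (t + \<epsilon>) (t' + \<epsilon>) (\<beta> t y))) \<and>
        (\<forall>t. \<forall>x\<in>mspace P t. \<beta> (t + \<epsilon>) (\<alpha> t x) = mmap P t (t + 2 * \<epsilon>) x) \<and>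
        (\<forall>t. \<forall>y\<in>mspace Q t. \<alpha> (t + \<epsilon>) (\<beta> t y) = mmap Q t (t + 2 * \<epsilon>) y))"

definition d_int ::
  "('k::field, 'v::ab_group_add) pmodule \<Rightarrow> ('k, 'w::ab_group_add) pmodule \<Rightarrow> ennreal" where
  "d_int P Q = (INF \<epsilon>\<in>{\<epsilon>. 0 < \<epsilon> \<and> interleaved \<epsilon> P Q}. ennreal \<epsilon>)"

text \<open>
  Finite formal linear combinations of elements of a set \<open>S\<close> are the finitely supported functions
  \<open>p\<close> with \<open>keys p \<subseteq> S\<close>; the basis element \<open>b\<close> is \<open>Poly_Mapping.single b 1\<close>.
\<close>

definition free_scale :: "'k::field \<Rightarrow> ('b \<Rightarrow>\<^sub>0 'k) \<Rightarrow> ('b \<Rightarrow>\<^sub>0 'k)" where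
  "free_scale c = Poly_Mapping.map ((*) c)"

definition free_space :: "'b set \<Rightarrow> ('b \<Rightarrow>\<^sub>0 'k::field) set" where
  "free_space S = {p. Poly_Mapping.keys p \<subseteq> S}"

definition free_map :: "('b \<Rightarrow> 'c) \<Rightarrow> ('b \<Rightarrow>\<^sub>0 'k::field) \<Rightarrow> ('c \<Rightarrow>\<^sub>0 'k)" where
  "free_map \<phi> p = (\<Sum>b\<in>Poly_Mapping.keys p. Poly_Mapping.single (\<phi> b) (Poly_Mapping.lookup p b))"

definition scc_module ::
  "(real \<Rightarrow> 'a pair_pre_digraph) \<Rightarrow> ('k::field, 'a set \<Rightarrow>\<^sub>0 'k) pmodule" where
  "scc_module D =
     \<lparr> mscale = free_scale,
       mspace = (\<lambda>t. free_space (scc_set (D t))),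
       mmap = (\<lambda>t s. free_map (scc_map D s)) \<rparr>"


subsection \<open>Well-definedness\<close>

lemma digraph_filtration_assoc_digraph: "digraph_filtration (assoc_digraph X f)"
  by (auto simp: digraph_filtration_def subgraph_def compatible_def assoc_digraph_def
      wf_digraph_def)

lemma scc_eq: "scc G v = {w. v \<rightarrow>\<^sup>*\<^bsub>with_proj G\<^esub> w \<and> w \<rightarrow>\<^sup>*\<^bsub>with_proj G\<^esub> v}"
  by (simp add: scc_def pre_digraph.scc_of_def)

lemma pverts_filtration_mono:
  assumes "digraph_filtration D" "t \<le> s" "v \<in> pverts (D t)"
  shows "v \<in> pverts (D s)"
proof -
  have "subgraph (with_proj (D t)) (with_proj (D s))"
    using assms(1,2) by (simp add: digraph_filtration_def)
  then show ?thesis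
    using assms(3) by (auto simp: subgraph_def)
qed

lemma reachable_filtration_mono:
  assumes "digraph_filtration D" "t \<le> s" "v \<rightarrow>\<^sup>*\<^bsub>with_proj (D t)\<^esub> w"
  shows "v \<rightarrow>\<^sup>*\<^bsub>with_proj (D s)\<^esub> w"
proof (rule pre_digraph.reachable_mono[OF assms(3)])
  show "subgraph (with_proj (D t)) (with_proj (D s))"
    using assms(1,2) by (simp add: digraph_filtration_def)
qed

lemma reachable_pair_trans:
  assumes "u \<rightarrow>\<^sup>*\<^bsub>with_proj G\<^esub> v" "v \<rightarrow>\<^sup>*\<^bsub>with_proj G\<^esub> w"
  shows "u \<rightarrow>\<^sup>*\<^bsub>with_proj G\<^esub> w"
  using assms unfolding reachable_def by (rule rtrancl_on_trans)

lemma scc_self: "v \<in> pverts G \<Longrightarrow> v \<in> scc G v"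
  by (simp add: scc_eq reachable_def rtrancl_on.rtrancl_on_refl)

lemma scc_cong: "w \<in> scc G v \<Longrightarrow> scc G w = scc G v"
  unfolding scc_eq by (simp add: set_eq_iff) (metis reachable_pair_trans)

lemma scc_subset_verts: "scc G v \<subseteq> pverts G"
proof
  fix w assume "w \<in> scc G v"
  then have "v \<rightarrow>\<^sup>*\<^bsub>with_proj G\<^esub> w"
    by (simp add: scc_eq)
  then show "w \<in> pverts G"
    by (rule reachable_in_vertsE) simp
qed

lemma scc_map_scc:
  assumes D: "digraph_filtration D" and "t \<le> s" and v: "v \<in> pverts (D t)"
  shows "scc_map D s (scc (D t) v) = scc (D s) v"
proof -
  have "scc (D s) w = scc (D s) v" if "w \<in> scc (D t) v" for w
    using that reachable_filtration_mono[OF D \<open>t \<le> s\<close>]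
    by (intro scc_cong) (simp add: scc_eq)
  then have "scc (D s) ` scc (D t) v = {scc (D s) v}"
    using scc_self[OF v] by blast
  then show ?thesis
    by (simp add: scc_map_def)
qed

lemma scc_map_in:
  assumes D: "digraph_filtration D" and "t \<le> s" and "C \<in> scc_set (D t)"
  shows "scc_map D s C \<in> scc_set (D s)"
proof -
  from assms(3) obtain v where v: "v \<in> pverts (D t)" "C = scc (D t) v"
    by (auto simp: scc_set_def)
  moreover have "v \<in> pverts (D s)"
    by (rule pverts_filtration_mono[OF D \<open>t \<le> s\<close> v(1)])
  ultimately show ?thesis
    using scc_map_scc[OF D \<open>t \<le> s\<close>] by (auto simp: scc_set_def)
qed

lemma lookup_free_scale [simp]:
  "Poly_Mapping.lookup (free_scale c p) b = c * Poly_Mapping.lookup p b"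
  by (simp add: free_scale_def Poly_Mapping.map.rep_eq when_def)

lemma keys_free_scale: "Poly_Mapping.keys (free_scale c p) \<subseteq> Poly_Mapping.keys p"
  by (auto simp: Poly_Mapping.in_keys_iff)

lemma vector_space_free_scale: "vector_space (free_scale :: 'k::field \<Rightarrow> ('b \<Rightarrow>\<^sub>0 'k) \<Rightarrow> _)"
  by unfold_locales (auto intro!: poly_mapping_eqI simp: lookup_add algebra_simps)

lemma subspace_free_space:
  "module.subspace free_scale (free_space S :: ('b \<Rightarrow>\<^sub>0 'k::field) set)"
proof -
  interpret vector_space "free_scale :: 'k \<Rightarrow> ('b \<Rightarrow>\<^sub>0 'k) \<Rightarrow> _"
    by (rule vector_space_free_scale)
  show ?thesis
    unfolding free_space_def
  proof (intro subspaceI; unfold mem_Collect_eq)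
    show "Poly_Mapping.keys (0 :: 'b \<Rightarrow>\<^sub>0 'k) \<subseteq> S" by simp
  next
    fix p q :: "'b \<Rightarrow>\<^sub>0 'k"
    assume "Poly_Mapping.keys p \<subseteq> S" "Poly_Mapping.keys q \<subseteq> S"
    then show "Poly_Mapping.keys (p + q) \<subseteq> S"
      using Poly_Mapping.keys_add[of p q] by (meson Un_least order_trans)
  next
    fix c and p :: "'b \<Rightarrow>\<^sub>0 'k"
    assume "Poly_Mapping.keys p \<subseteq> S"
    then show "Poly_Mapping.keys (free_scale c p) \<subseteq> S"
      using keys_free_scale[of c p] by (rule order_trans[rotated])
  qed
qed

lemma free_map_superset:
  assumes "finite A" "Poly_Mapping.keys p \<subseteq> A"
  shows "free_map \<phi> p = (\<Sum>b\<in>A. Poly_Mapping.single (\<phi> b) (Poly_Mapping.lookup p b))"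
  unfolding free_map_def using assms
  by (intro sum.mono_neutral_left) (auto simp: Poly_Mapping.in_keys_iff)

lemma free_map_single [simp]:
  "free_map \<phi> (Poly_Mapping.single b c) = Poly_Mapping.single (\<phi> b) c"
  by (simp add: free_map_def)

lemma free_map_add: "free_map \<phi> (p + q) = free_map \<phi> p + free_map \<phi> q"
proof -
  let ?A = "Poly_Mapping.keys p \<union> Poly_Mapping.keys q"
  show ?thesis
    using Poly_Mapping.keys_add[of p q]
    by (simp add: free_map_superset[of ?A] lookup_add single_add sum.distrib)
qed

lemma free_map_scale: "free_map \<phi> (free_scale c p) = free_scale c (free_map \<phi> p)"
proof -
  have "free_map \<phi> (free_scale c p) =
      (\<Sum>b\<in>Poly_Mapping.keys p. Poly_Mapping.single (\<phi> b) (c * Poly_Mapping.lookup p b))"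
    by (simp add: free_map_superset[OF _ keys_free_scale])
  then show ?thesis
    by (intro poly_mapping_eqI)
       (simp add: free_map_def lookup_sum lookup_single sum_distrib_left mult_when)
qed

lemma free_map_sum: "free_map \<phi> (sum h A) = (\<Sum>a\<in>A. free_map \<phi> (h a))"
  by (induction A rule: infinite_finite_induct) (auto simp: free_map_add, simp_all add: free_map_def)

lemma free_map_comp: "free_map \<psi> (free_map \<phi> p) = free_map (\<lambda>b. \<psi> (\<phi> b)) p"
  unfolding free_map_def[of \<phi>] free_map_sum by (simp add: free_map_def[of "\<lambda>b. \<psi> (\<phi> b)"])

lemma free_map_cong:
  "(\<And>b. b \<in> Poly_Mapping.keys p \<Longrightarrow> \<phi> b = \<psi> b) \<Longrightarrow> free_map \<phi> p = free_map \<psi> p"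
  by (simp add: free_map_def)

lemma free_map_ident: "free_map (\<lambda>b. b) p = p"
  by (rule poly_mapping_eqI)
     (simp add: free_map_def lookup_sum lookup_single when_def sum.delta Poly_Mapping.in_keys_iff)

lemma free_map_in:
  assumes "\<And>b. b \<in> S \<Longrightarrow> \<phi> b \<in> T" "p \<in> free_space S"
  shows "free_map \<phi> p \<in> free_space T"
proof -
  have "Poly_Mapping.keys (free_map \<phi> p) \<subseteq> \<phi> ` Poly_Mapping.keys p"
    unfolding free_map_def by (rule order_trans[OF Poly_Mapping.keys_sum]) (auto split: if_splits)
  with assms show ?thesis
    unfolding free_space_def by blast
qed

theorem persistence_module_scc_module:
  assumes D: "digraph_filtration D"
  shows "persistence_module (scc_module D :: ('k::field, 'a set \<Rightarrow>\<^sub>0 'k) pmodule)"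
proof -
  have id: "free_map (scc_map D t) x = x"
    if "x \<in> free_space (scc_set (D t))" for t and x :: "'a set \<Rightarrow>\<^sub>0 'k"
  proof -
    have "scc_map D t C = C" if "C \<in> scc_set (D t)" for C
      using that scc_map_scc[OF D order_refl] by (auto simp: scc_set_def)
    with that have "free_map (scc_map D t) x = free_map (\<lambda>C. C) x"
      by (intro free_map_cong) (auto simp: free_space_def)
    then show ?thesis
      by (simp add: free_map_ident)
  qed
  have comp: "free_map (scc_map D r) x = free_map (scc_map D r) (free_map (scc_map D s) x)"
    if "t \<le> s" "s \<le> r" "x \<in> free_space (scc_set (D t))" for t s r and x :: "'a set \<Rightarrow>\<^sub>0 'k"
  proof -
    have "scc_map D r C = scc_map D r (scc_map D s C)" if C: "C \<in> scc_set (D t)" for C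
    proof -
      from C obtain v where v: "v \<in> pverts (D t)" "C = scc (D t) v"
        by (auto simp: scc_set_def)
      have "v \<in> pverts (D s)"
        by (rule pverts_filtration_mono[OF D \<open>t \<le> s\<close> v(1)])
      then show ?thesis
        using v \<open>t \<le> s\<close> \<open>s \<le> r\<close> by (simp add: scc_map_scc[OF D])
    qed
    with that(3) show ?thesis
      unfolding free_map_comp by (intro free_map_cong) (auto simp: free_space_def)
  qed
  have lin: "linear_between free_scale (free_space (scc_set (D t)) :: ('a set \<Rightarrow>\<^sub>0 'k) set)
      free_scale (free_space (scc_set (D s))) (free_map (scc_map D s))" if "t \<le> s" for t s
    unfolding linear_between_def
    by (simp add: free_map_add free_map_scale)
       (blast intro: free_map_in[where S = "scc_set (D t)"] scc_map_in[OF D that])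
  show ?thesis
    unfolding persistence_module_def scc_module_def pmodule.simps
  proof (intro conjI allI impI ballI)
    fix t s r :: real and x :: "'a set \<Rightarrow>\<^sub>0 'k"
    assume "t \<le> s" "s \<le> r" "x \<in> free_space (scc_set (D t))"
    then show "free_map (scc_map D r) x = free_map (scc_map D r) (free_map (scc_map D s) x)"
      by (rule comp)
  qed (fact vector_space_free_scale subspace_free_space | rule lin id, assumption)+
qed

end

theory Submission
  imports Defs
begin

text \<open>
  Choosing partners along a correspondence of distortion less than \<open>\<epsilon>\<close> gives maps of vertices in
  both directions that are digraph morphisms up to raising the parameter by \<open>\<epsilon>\<close>. A vertex \<open>x\<close> and
  its image \<open>x'\<close> under the round trip have a common partner \<open>y\<close>, so all of \<open>f x x'\<close>, \<open>f x' x\<close> and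
  \<open>f x' x'\<close> are within \<open>\<epsilon>\<close> of \<open>g y y\<close>, hence at most \<open>f x x + 2\<epsilon>\<close>; thus \<open>x\<close> and \<open>x'\<close> are strongly
  connected after raising the parameter by \<open>2\<epsilon>\<close>, and the induced maps on components form an
  \<open>\<epsilon>\<close>-interleaving.
\<close>

definition digraph_hom :: "('a \<Rightarrow> 'b) \<Rightarrow> 'a pair_pre_digraph \<Rightarrow> 'b pair_pre_digraph \<Rightarrow> bool" where
  "digraph_hom h G H \<longleftrightarrow>
     (\<forall>x\<in>pverts G. h x \<in> pverts H) \<and> (\<forall>(x, y)\<in>parcs G. (h x, h y) \<in> parcs H)"

lemma digraph_hom_pverts: "digraph_hom h G H \<Longrightarrow> x \<in> pverts G \<Longrightarrow> h x \<in> pverts H"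
  by (simp add: digraph_hom_def)

lemma digraph_hom_reachable:
  assumes h: "digraph_hom h G H" and "v \<rightarrow>\<^sup>*\<^bsub>with_proj G\<^esub> w"
  shows "h v \<rightarrow>\<^sup>*\<^bsub>with_proj H\<^esub> h w"
proof -
  have "(v, w) \<in> rtrancl_on (pverts G) (parcs G)"
    using assms(2) by (simp add: reachable_def)
  then have "(h v, h w) \<in> rtrancl_on (pverts H) (parcs H)"
  proof (induction rule: rtrancl_on_induct)
    case base
    then show ?case using h by (auto simp: digraph_hom_def)
  next
    case (step y z)
    then have "h z \<in> pverts H" "(h y, h z) \<in> parcs H"
      using h by (auto simp: digraph_hom_def)
    with step.IH show ?case by (blast intro: rtrancl_on_into_rtrancl_on)
  qed
  then show ?thesis by (simp add: reachable_def)
qed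

text \<open>For a homomorphism \<open>h\<close> and a component \<open>C\<close> the set under
  \<open>the_elem\<close> is a singleton; \<open>scc_map\<close> is the case where \<open>h\<close>
  is the identity.\<close>

definition scc_image :: "'b pair_pre_digraph \<Rightarrow> ('a \<Rightarrow> 'b) \<Rightarrow> 'a set \<Rightarrow> 'b set" where
  "scc_image H h C = the_elem ((\<lambda>v. scc H (h v)) ` C)"

text \<open>Paths both ways between \<open>v\<close> and \<open>w\<close> are mapped to paths both
  ways between \<open>h v\<close> and \<open>h w\<close>, so the choice of representative does not
  matter.\<close>

lemma scc_image_scc:
  assumes h: "digraph_hom h G H" and v: "v \<in> pverts G"
  shows "scc_image H h (scc G v) = scc H (h v)"
proof -
  have "scc H (h w) = scc H (h v)" if "w \<in> scc G v" for w
    using that digraph_hom_reachable[OF h] by (intro scc_cong) (simp add: scc_eq)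
  then have "(\<lambda>v. scc H (h v)) ` scc G v = {scc H (h v)}"
    using scc_self[OF v] by blast
  then show ?thesis by (simp add: scc_image_def)
qed

lemma linear_between_free_map:
  assumes "\<And>b. b \<in> S \<Longrightarrow> \<phi> b \<in> T"
  shows "linear_between free_scale (free_space S :: ('b \<Rightarrow>\<^sub>0 'k::field) set)
           free_scale (free_space T) (free_map \<phi>)"
  unfolding linear_between_def
  by (simp add: free_map_add free_map_scale) (blast intro: free_map_in[of S] assms)

lemma linear_between_scc_image:
  assumes "digraph_hom h G H"
  shows "linear_between free_scale (free_space (scc_set G) :: ('a set \<Rightarrow>\<^sub>0 'k::field) set)
           free_scale (free_space (scc_set H)) (free_map (scc_image H h))"
  using scc_image_scc[OF assms] digraph_hom_pverts[OF assms]
  by (intro linear_between_free_map) (auto simp: scc_set_def)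

lemma free_map_scc_cong:
  assumes "p \<in> free_space (scc_set G)"
    and "\<And>v. v \<in> pverts G \<Longrightarrow> \<phi> (scc G v) = \<psi> (scc G v)"
  shows "free_map \<phi> p = free_map \<psi> p"
  using assms by (intro free_map_cong) (auto simp: free_space_def scc_set_def)

text \<open>Because one vertex map \<open>h\<close> serves all parameters, both composites send the
  component of \<open>v\<close> to that of \<open>h v\<close> in \<open>E (s + \<epsilon>)\<close>;
  agreement on basis elements is enough.\<close>

lemma scc_image_natural:
  assumes D: "digraph_filtration D" and E: "digraph_filtration E"
    and h: "\<And>t. digraph_hom h (D t) (E (t + \<epsilon>))"
    and "t \<le> s" and p: "p \<in> free_space (scc_set (D t))"
  shows "free_map (scc_image (E (s + \<epsilon>)) h) (free_map (scc_map D s) p) =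
         free_map (scc_map E (s + \<epsilon>)) (free_map (scc_image (E (t + \<epsilon>)) h) p)"
  unfolding free_map_comp using p
proof (rule free_map_scc_cong)
  fix v assume v: "v \<in> pverts (D t)"
  have "v \<in> pverts (D s)"
    by (rule pverts_filtration_mono[OF D \<open>t \<le> s\<close> v])
  moreover have "t + \<epsilon> \<le> s + \<epsilon>" using \<open>t \<le> s\<close> by simp
  ultimately show "scc_image (E (s + \<epsilon>)) h (scc_map D s (scc (D t) v)) =
      scc_map E (s + \<epsilon>) (scc_image (E (t + \<epsilon>)) h (scc (D t) v))"
    using v \<open>t \<le> s\<close> digraph_hom_pverts[OF h v]
    by (simp add: scc_map_scc[OF D] scc_map_scc[OF E] scc_image_scc[OF h])
qed

text \<open>On the component of \<open>v\<close> the two sides give the components of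
  \<open>k (h v)\<close> and of \<open>v\<close> in \<open>D (t + 2 * \<epsilon>)\<close>, which
  \<open>kh\<close> identifies.\<close>

lemma scc_image_round_trip:
  assumes D: "digraph_filtration D" and "0 \<le> \<epsilon>"
    and h: "\<And>t. digraph_hom h (D t) (E (t + \<epsilon>))"
    and k: "\<And>t. digraph_hom k (E t) (D (t + \<epsilon>))"
    and kh: "\<And>t v. v \<in> pverts (D t) \<Longrightarrow> k (h v) \<in> scc (D (t + 2 * \<epsilon>)) v"
    and p: "p \<in> free_space (scc_set (D t))"
  shows "free_map (scc_image (D (t + \<epsilon> + \<epsilon>)) k) (free_map (scc_image (E (t + \<epsilon>)) h) p) =
         free_map (scc_map D (t + 2 * \<epsilon>)) p"
  unfolding free_map_comp using p
proof (rule free_map_scc_cong)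
  fix v assume v: "v \<in> pverts (D t)"
  have "t \<le> t + 2 * \<epsilon>" using \<open>0 \<le> \<epsilon>\<close> by simp
  \<comment> \<open>The second interleaving map is taken at \<open>t + \<epsilon>\<close> and so
    lands at \<open>t + \<epsilon> + \<epsilon>\<close>, whereas \<open>interleaved\<close> writes
    the index as \<open>t + 2 * \<epsilon>\<close>.\<close>
  moreover have "t + \<epsilon> + \<epsilon> = t + 2 * \<epsilon>" by simp
  ultimately show "scc_image (D (t + \<epsilon> + \<epsilon>)) k (scc_image (E (t + \<epsilon>)) h (scc (D t) v)) =
      scc_map D (t + 2 * \<epsilon>) (scc (D t) v)"
    using v scc_image_scc[OF k digraph_hom_pverts[OF h v]] scc_cong[OF kh[OF v]]
    by (simp only: scc_map_scc[OF D] scc_image_scc[OF h])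
qed

lemma interleaved_scc_module:
  assumes D: "digraph_filtration D" and E: "digraph_filtration E" and "0 \<le> \<epsilon>"
    and h: "\<And>t. digraph_hom h (D t) (E (t + \<epsilon>))"
    and k: "\<And>t. digraph_hom k (E t) (D (t + \<epsilon>))"
    and kh: "\<And>t v. v \<in> pverts (D t) \<Longrightarrow> k (h v) \<in> scc (D (t + 2 * \<epsilon>)) v"
    and hk: "\<And>t v. v \<in> pverts (E t) \<Longrightarrow> h (k v) \<in> scc (E (t + 2 * \<epsilon>)) v"
  shows "interleaved \<epsilon> (scc_module D :: ('k::field, 'a set \<Rightarrow>\<^sub>0 'k) pmodule)
           (scc_module E :: ('k, 'b set \<Rightarrow>\<^sub>0 'k) pmodule)"
  unfolding interleaved_def scc_module_def pmodule.simps
  by (rule exI[of _ "\<lambda>t. free_map (scc_image (E (t + \<epsilon>)) h)"],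
      rule exI[of _ "\<lambda>t. free_map (scc_image (D (t + \<epsilon>)) k)"])
     (intro conjI allI ballI impI linear_between_scc_image h k
       scc_image_natural[where D = D and E = E, OF D E h]
       scc_image_natural[where D = E and E = D, OF E D k]
       scc_image_round_trip[where D = D and E = E, OF D \<open>0 \<le> \<epsilon>\<close> h k kh]
       scc_image_round_trip[where D = E and E = D, OF E \<open>0 \<le> \<epsilon>\<close> k h hk])

text \<open>Each of the three values in the edge condition grows by at most
  \<open>\<epsilon>\<close>; the case \<open>x' = x\<close> takes care of the vertices.\<close>

lemma digraph_hom_assoc_digraph:
  assumes "\<And>x. x \<in> X \<Longrightarrow> h x \<in> Y"
    and "\<And>x x'. x \<in> X \<Longrightarrow> x' \<in> X \<Longrightarrow> g (h x) (h x') \<le> f x x' + \<epsilon>"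
  shows "digraph_hom h (assoc_digraph X f t) (assoc_digraph Y g (t + \<epsilon>))"
proof -
  have "g (h x) (h x') \<le> t + \<epsilon>" if "x \<in> X" "x' \<in> X" "f x x' \<le> t" for x x'
    using assms(2)[OF that(1,2)] that(3) by linarith
  then show ?thesis
    using assms(1) by (auto simp: digraph_hom_def assoc_digraph_def)
qed

lemma scc_assoc_digraphI:
  assumes "x \<in> X" "x' \<in> X" "f x x \<le> t" "f x' x' \<le> t" "f x x' \<le> t" "f x' x \<le> t"
  shows "x' \<in> scc (assoc_digraph X f t) x"
proof -
  let ?R = "rtrancl_on (pverts (assoc_digraph X f t)) (parcs (assoc_digraph X f t))"
  have "(x, x') \<in> ?R" "(x', x) \<in> ?R"
    using assms by (auto intro!: rtrancl_on_into_rtrancl_on[OF rtrancl_on_refl]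
        simp: assoc_digraph_def)
  then show ?thesis
    by (simp add: scc_eq reachable_def)
qed

lemma interleaved_if_correspondence:
  assumes M: "correspondence X Y M" and "0 \<le> \<epsilon>"
    and le: "\<And>x1 y1 x2 y2. (x1, y1) \<in> M \<Longrightarrow> (x2, y2) \<in> M \<Longrightarrow> \<bar>f x1 x2 - g y1 y2\<bar> \<le> \<epsilon>"
  shows "interleaved \<epsilon> (scc_module (assoc_digraph X f) :: ('k::field, 'x set \<Rightarrow>\<^sub>0 'k) pmodule)
           (scc_module (assoc_digraph Y g) :: ('k, 'y set \<Rightarrow>\<^sub>0 'k) pmodule)"
proof -
  \<comment> \<open>The chosen maps need not be mutually inverse, but \<open>x\<close> and
    \<open>k (h x)\<close> are both partners of \<open>h x\<close>, and \<open>y\<close> and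
    \<open>h (k y)\<close> are both partners of \<open>k y\<close>.\<close>
  obtain h where h: "\<And>x. x \<in> X \<Longrightarrow> h x \<in> Y \<and> (x, h x) \<in> M"
    using M unfolding correspondence_def by metis
  obtain k where k: "\<And>y. y \<in> Y \<Longrightarrow> k y \<in> X \<and> (k y, y) \<in> M"
    using M unfolding correspondence_def by metis
  have near: "f x1 x2 \<le> g y1 y2 + \<epsilon>" "g y1 y2 \<le> f x1 x2 + \<epsilon>"
    if "(x1, y1) \<in> M" "(x2, y2) \<in> M" for x1 y1 x2 y2
    using le[OF that] by linarith+
  have kh: "k (h x) \<in> scc (assoc_digraph X f (t + 2 * \<epsilon>)) x"
    if "x \<in> pverts (assoc_digraph X f t)" for t x
  proof -
    from that have x: "x \<in> X" "f x x \<le> t" by (auto simp: assoc_digraph_def)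
    \<comment> \<open>Here \<open>a\<close> and \<open>b\<close> range over \<open>x\<close> and
      \<open>k (h x)\<close>, which covers all four bounds of \<open>scc_assoc_digraphI\<close>.
      Comparing through \<open>g (h x) (h x)\<close> costs \<open>\<epsilon>\<close> twice.\<close>
    have "f a b \<le> t + 2 * \<epsilon>" if "(a, h x) \<in> M" "(b, h x) \<in> M" for a b
      using near(1)[OF that] near(2)[of x "h x" x "h x"] h[OF x(1)] x(2) by auto
    then show ?thesis
      using h[OF x(1)] k[of "h x"] x(1) by (intro scc_assoc_digraphI) auto
  qed
  have hk: "h (k y) \<in> scc (assoc_digraph Y g (t + 2 * \<epsilon>)) y"
    if "y \<in> pverts (assoc_digraph Y g t)" for t y
  proof -
    from that have y: "y \<in> Y" "g y y \<le> t" by (auto simp: assoc_digraph_def)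
    have "g a b \<le> t + 2 * \<epsilon>" if "(k y, a) \<in> M" "(k y, b) \<in> M" for a b
      using near(2)[OF that] near(1)[of "k y" y "k y" y] k[OF y(1)] y(2) by auto
    then show ?thesis
      using k[OF y(1)] h[of "k y"] y(1) by (intro scc_assoc_digraphI) auto
  qed
  show ?thesis
    using h k near
    by (intro interleaved_scc_module[of _ _ _ h k] digraph_filtration_assoc_digraph
        digraph_hom_assoc_digraph \<open>0 \<le> \<epsilon>\<close> kh hk) auto
qed

lemma le_distortion:
  assumes "(x1, y1) \<in> M" "(x2, y2) \<in> M"
  shows "ennreal \<bar>f x1 x2 - g y1 y2\<bar> \<le> distortion f g M"
  unfolding distortion_def
  by (rule SUP_upper2[OF assms(1)], simp, rule SUP_upper2[OF assms(2)], simp)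

lemma d_int_le_distortion:
  assumes M: "correspondence X Y M"
  shows "d_int (scc_module (assoc_digraph X f) :: ('k::field, 'x set \<Rightarrow>\<^sub>0 'k) pmodule)
           (scc_module (assoc_digraph Y g) :: ('k, 'y set \<Rightarrow>\<^sub>0 'k) pmodule) \<le> distortion f g M"
    (is "?d \<le> _")
\<comment> \<open>The slack \<open>e\<close> is there because \<open>d_int\<close> ranges over
  positive parameters only, while the distortion may be 0. The rule also supplies finiteness of the
  distortion, which makes it a real \<open>r\<close>.\<close>
proof (rule ennreal_le_epsilon)
  fix e :: real assume "distortion f g M < top" and e: "0 < e"
  then obtain r where r: "0 \<le> r" "distortion f g M = ennreal r"
    by (cases "distortion f g M") auto
  have "\<bar>f x1 x2 - g y1 y2\<bar> \<le> r + e" if "(x1, y1) \<in> M" "(x2, y2) \<in> M" for x1 y1 x2 y2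
    using le_distortion[OF that, of f g] r e by (simp add: ennreal_le_iff)
  then have "interleaved (r + e) (scc_module (assoc_digraph X f) :: ('k, 'x set \<Rightarrow>\<^sub>0 'k) pmodule)
      (scc_module (assoc_digraph Y g) :: ('k, 'y set \<Rightarrow>\<^sub>0 'k) pmodule)"
    using M r(1) e by (intro interleaved_if_correspondence) auto
  then have "?d \<le> ennreal (r + e)"
    unfolding d_int_def using r(1) e by (intro INF_lower) auto
  then show "?d \<le> distortion f g M + ennreal e"
    using r e by simp
qed

theorem theorem27:
  fixes X :: "'x set" and f :: "'x \<Rightarrow> 'x \<Rightarrow> real"
    and Y :: "'y set" and g :: "'y \<Rightarrow> 'y \<Rightarrow> real"
  assumes "d_CD X f Y g < \<infinity>"
  shows "d_int
           (scc_module (assoc_digraph X f) :: ('k::field, 'x set \<Rightarrow>\<^sub>0 'k) pmodule)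
           (scc_module (assoc_digraph Y g) :: ('k, 'y set \<Rightarrow>\<^sub>0 'k) pmodule)
         \<le> 2 * d_CD X f Y g"
proof -
  \<comment> \<open>The factor 2 cancels the one half in \<open>d_CD\<close>, so it remains to bound
    \<open>d_int\<close> by the distortion of each single correspondence.\<close>
  have "2 * d_CD X f Y g = (INF M\<in>{M. correspondence X Y M}. distortion f g M)"
    unfolding d_CD_def mult.assoc[symmetric]
    by (simp add: ennreal_times_divide ennreal_divide_self)
  then show ?thesis
    by (auto intro!: INF_greatest d_int_le_distortion)
qed

end
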